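(* Let $(P,\ast,[-,-],\varepsilon,\alpha,\beta)$ be a BiHom-Poisson color algebra and let $\delta:G\times G\to\mathbb{K}^*$ be the bicharacter associated with a multiplier $\sigma$ on $G$. Then $(P,\ast^\sigma,[-,-]^\sigma,\varepsilon\delta,\alpha,\beta)$ is also a BiHom-Poisson color algebra, where $$x\ast^\sigma y=\sigma(x,y)\,x\ast y,\qquad [x,y]^\sigma=\sigma(x,y)[x,y],\qquad \varepsilon\delta(x,y)=\varepsilon(x,y)\sigma(x,y)\sigma(y,x)^{-1}$$ for all homogeneous $x,y\in P$. Moreover, every endomorphism of $(P,\ast,[-,-],\varepsilon,\alpha,\beta)$ is also an endomorphism of $(P,\ast^\sigma,[-,-]^\sigma,\varepsilon\delta,\alpha,\beta)$.
   Context: $\mathbb{K}$ is a field of characteristic different from 2 and $G$ is an abelian group (written additively). A skew-symmetric bicharacter on $G$ is a map $\varepsilon:G\times G\to\mathbb{K}^*$ with $\varepsilon(g,g')\varepsilon(g',g)=1$, $\varepsilon(g,g'+g'')=\varepsilon(g,g')\varepsilon(g,g'')$, $\varepsilon(g+g',g'')=\varepsilon(g,g'')\varepsilon(g',g'')$; $\varepsilon$ denotes such a bicharacter. For homogeneous $x,y$ of degrees $g,g'$ one writes $\varepsilon(x,y)=\varepsilon(g,g')$, and likewise $\sigma(x,y)=\sigma(g,g')$, $\delta(x,y)=\delta(g,g')$. A linear map is even if it preserves degrees; a bilinear map $\mu$ is even if $\mu(V_g,V_{g'})\subseteq V_{g+g'}$. A multiplier on $G$ is a map $\sigma:G\times G\to\mathbb{K}^*$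 with $\sigma(g,g'+g'')\sigma(g',g'')=\sigma(g,g')\sigma(g+g',g'')$ for all $g,g',g''\in G$; the bicharacter associated with $\sigma$ is $\delta(g,g')=\sigma(g,g')\sigma(g',g)^{-1}$. A BiHom-Poisson color algebra $(P,\ast,[-,-],\varepsilon,\alpha,\beta)$ is a $G$-graded $\mathbb{K}$-vector space $P$ with an even bilinear product $\ast$, an even bilinear bracket $[-,-]$, and even linear maps $\alpha,\beta:P\to P$ such that $\alpha\beta=\beta\alpha$, $\alpha$ and $\beta$ are multiplicative for both the product and the bracket, and for all homogeneous $x,y,z$: - $\alpha(x)\ast(y\ast z)=(x\ast y)\ast\beta(z)$; - $[\beta(x),\alpha(y)]=-\varepsilon(x,y)[\beta(y),\alpha(x)]$; - $\oint_{x,y,z}\varepsilon(z,x)[\beta^2(x),[\beta(y),\alpha(z)]]=0$ (cyclic sum over $x,y,z$); - $[\alpha\beta(x),y\ast z]=[\beta(x),y]\ast\beta(z)+\varepsilon(x,y)\,\beta(y)\ast[\alpha(x),z]$. An endomorphism of a BiHom-Poisson color algebra is an even linear self-map preserving product and bracket and commuting with $\alpha$ and $\beta$. *)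

theory Defs
  imports Complex_Main
begin

definition skew_symmetric_bicharacter :: "('g::ab_group_add \<Rightarrow> 'g \<Rightarrow> 'k::field) \<Rightarrow> bool" where
  "skew_symmetric_bicharacter \<epsilon> \<longleftrightarrow>
     (\<forall>g h. \<epsilon> g h \<noteq> 0) \<and>
     (\<forall>g h. \<epsilon> g h * \<epsilon> h g = 1) \<and>
     (\<forall>g h k. \<epsilon> g (h + k) = \<epsilon> g h * \<epsilon> g k) \<and>
     (\<forall>g h k. \<epsilon> (g + h) k = \<epsilon> g k * \<epsilon> h k)"

definition multiplier :: "('g::ab_group_add \<Rightarrow> 'g \<Rightarrow> 'k::field) \<Rightarrow> bool" where
  "multiplier \<sigma> \<longleftrightarrow>
     (\<forall>g h. \<sigma> g h \<noteq> 0) \<and>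
     (\<forall>g h k. \<sigma> g (h + k) * \<sigma> h k = \<sigma> g h * \<sigma> (g + h) k)"

definition associated_bicharacter :: "('g \<Rightarrow> 'g \<Rightarrow> 'k::field) \<Rightarrow> 'g \<Rightarrow> 'g \<Rightarrow> 'k" where
  "associated_bicharacter \<sigma> g h = \<sigma> g h * inverse (\<sigma> h g)"

definition homogeneous_decomposition ::
    "('g \<Rightarrow> 'v::ab_group_add set) \<Rightarrow> 'v \<Rightarrow> ('g \<Rightarrow> 'v) \<Rightarrow> bool" where
  "homogeneous_decomposition V x c \<longleftrightarrow>
     (\<forall>g. c g \<in> V g) \<and> finite {g. c g \<noteq> 0} \<and> x = (\<Sum>g\<in>{g. c g \<noteq> 0}. c g)"

text \<open>The whole type \<open>'v\<close> is the internal direct sum of the subspaces \<open>V g\<close>.\<close>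

locale graded_vector_space = vector_space scale
  for scale :: "'k::field \<Rightarrow> 'v::ab_group_add \<Rightarrow> 'v" +
  fixes V :: "'g::ab_group_add \<Rightarrow> 'v set"
  assumes subspace_V: "subspace (V g)"
    and unique_decomposition: "\<exists>!c. homogeneous_decomposition V x c"

definition even_map :: "('g \<Rightarrow> 'v set) \<Rightarrow> ('v \<Rightarrow> 'v) \<Rightarrow> bool" where
  "even_map V f \<longleftrightarrow> (\<forall>g. \<forall>x\<in>V g. f x \<in> V g)"

definition even_bimap :: "('g::ab_group_add \<Rightarrow> 'v set) \<Rightarrow> ('v \<Rightarrow> 'v \<Rightarrow> 'v) \<Rightarrow> bool" where
  "even_bimap V m \<longleftrightarrow> (\<forall>g h. \<forall>x\<in>V g. \<forall>y\<in>V h. m x y \<in> V (g + h))"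

definition bilinear_map ::
    "('k::field \<Rightarrow> 'v::ab_group_add \<Rightarrow> 'v) \<Rightarrow> ('v \<Rightarrow> 'v \<Rightarrow> 'v) \<Rightarrow> bool" where
  "bilinear_map scale m \<longleftrightarrow>
     (\<forall>x. Vector_Spaces.linear scale scale (m x)) \<and>
     (\<forall>y. Vector_Spaces.linear scale scale (\<lambda>x. m x y))"

locale bihom_poisson_color_algebra = graded_vector_space scale V
  for scale :: "'k::field \<Rightarrow> 'v::ab_group_add \<Rightarrow> 'v"
    and V :: "'g::ab_group_add \<Rightarrow> 'v set" +
  fixes mult :: "'v \<Rightarrow> 'v \<Rightarrow> 'v"
    and bracket :: "'v \<Rightarrow> 'v \<Rightarrow> 'v"
    and \<epsilon> :: "'g \<Rightarrow> 'g \<Rightarrow> 'k"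
    and \<alpha> \<beta> :: "'v \<Rightarrow> 'v"
  assumes bicharacter: "skew_symmetric_bicharacter \<epsilon>"
    and bilinear_mult: "bilinear_map scale mult"
    and even_mult: "even_bimap V mult"
    and bilinear_bracket: "bilinear_map scale bracket"
    and even_bracket: "even_bimap V bracket"
    and linear_\<alpha>: "Vector_Spaces.linear scale scale \<alpha>"
    and even_\<alpha>: "even_map V \<alpha>"
    and linear_\<beta>: "Vector_Spaces.linear scale scale \<beta>"
    and even_\<beta>: "even_map V \<beta>"
    and commute: "\<alpha> (\<beta> x) = \<beta> (\<alpha> x)"
    and \<alpha>_mult: "\<alpha> (mult x y) = mult (\<alpha> x) (\<alpha> y)"
    and \<alpha>_bracket: "\<alpha> (bracket x y) = bracket (\<alpha> x) (\<alpha> y)"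
    and \<beta>_mult: "\<beta> (mult x y) = mult (\<beta> x) (\<beta> y)"
    and \<beta>_bracket: "\<beta> (bracket x y) = bracket (\<beta> x) (\<beta> y)"
    and bihom_associative:
      "\<lbrakk>x \<in> V g; y \<in> V h; z \<in> V k\<rbrakk> \<Longrightarrow> mult (\<alpha> x) (mult y z) = mult (mult x y) (\<beta> z)"
    and bihom_skew_symmetric:
      "\<lbrakk>x \<in> V g; y \<in> V h\<rbrakk> \<Longrightarrow>
        bracket (\<beta> x) (\<alpha> y) = - scale (\<epsilon> g h) (bracket (\<beta> y) (\<alpha> x))"
    and bihom_jacobi:
      "\<lbrakk>x \<in> V g; y \<in> V h; z \<in> V k\<rbrakk> \<Longrightarrow>
        scale (\<epsilon> k g) (bracket (\<beta> (\<beta> x)) (bracket (\<beta> y) (\<alpha> z))) +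
        scale (\<epsilon> g h) (bracket (\<beta> (\<beta> y)) (bracket (\<beta> z) (\<alpha> x))) +
        scale (\<epsilon> h k) (bracket (\<beta> (\<beta> z)) (bracket (\<beta> x) (\<alpha> y))) = 0"
    and bihom_leibniz:
      "\<lbrakk>x \<in> V g; y \<in> V h; z \<in> V k\<rbrakk> \<Longrightarrow>
        bracket (\<alpha> (\<beta> x)) (mult y z) =
        mult (bracket (\<beta> x) y) (\<beta> z) +
        scale (\<epsilon> g h) (mult (\<beta> y) (bracket (\<alpha> x) z))"

definition bihom_poisson_endomorphism ::
    "('k::field \<Rightarrow> 'v::ab_group_add \<Rightarrow> 'v) \<Rightarrow> ('g \<Rightarrow> 'v set) \<Rightarrow>
     ('v \<Rightarrow> 'v \<Rightarrow> 'v) \<Rightarrow> ('v \<Rightarrow> 'v \<Rightarrow> 'v) \<Rightarrow> ('v \<Rightarrow> 'v) \<Rightarrow> ('v \<Rightarrow> 'v) \<Rightarrow> ('v \<Rightarrow> 'v) \<Rightarrow> bool" where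
  "bihom_poisson_endomorphism scale V mult bracket \<alpha> \<beta> f \<longleftrightarrow>
     Vector_Spaces.linear scale scale f \<and> even_map V f \<and>
     (\<forall>x y. f (mult x y) = mult (f x) (f y)) \<and>
     (\<forall>x y. f (bracket x y) = bracket (f x) (f y)) \<and>
     (\<forall>x. f (\<alpha> x) = \<alpha> (f x)) \<and>
     (\<forall>x. f (\<beta> x) = \<beta> (f x))"

definition homogeneous_component :: "('g \<Rightarrow> 'v::ab_group_add set) \<Rightarrow> 'v \<Rightarrow> 'g \<Rightarrow> 'v" where
  "homogeneous_component V x = (THE c. homogeneous_decomposition V x c)"

text \<open>The bilinear extension of \<open>(x, y) \<mapsto> \<sigma> g h \<cdot> m x y\<close> (\<open>x\<close> of degree \<open>g\<close>, \<open>y\<close> of degree \<open>h\<close>)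
  from homogeneous to arbitrary elements.\<close>

definition twist ::
    "('k::field \<Rightarrow> 'v::ab_group_add \<Rightarrow> 'v) \<Rightarrow> ('g \<Rightarrow> 'v set) \<Rightarrow> ('g \<Rightarrow> 'g \<Rightarrow> 'k) \<Rightarrow>
     ('v \<Rightarrow> 'v \<Rightarrow> 'v) \<Rightarrow> 'v \<Rightarrow> 'v \<Rightarrow> 'v" where
  "twist scale V \<sigma> m x y =
     (\<Sum>g\<in>{g. homogeneous_component V x g \<noteq> 0}. \<Sum>h\<in>{h. homogeneous_component V y h \<noteq> 0}.
        scale (\<sigma> g h) (m (homogeneous_component V x g) (homogeneous_component V y h)))"

end

theory Submission
  imports Defs
begin

text \<open>
  Put \<open>m\<^sup>\<sigma>\<close> for the twist of a bilinear map \<open>m\<close>. All axioms of a BiHom-Poisson color algebra compare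
  iterated products of three homogeneous elements of degrees \<open>g\<close>, \<open>h\<close>, \<open>k\<close>, and \<open>\<alpha>\<close>, \<open>\<beta>\<close> do not
  change degrees. Passing to the twisted operations therefore multiplies every term of an axiom by a
  scalar, and the point is that this scalar is common to all terms. For the two ways of
  bracketing this is the multiplier identity
  \<open>\<sigma>(g,h+k) \<sigma>(h,k) = \<sigma>(g,h) \<sigma>(g+h,k)\<close>; when two factors change places, the discrepancy
  \<open>\<sigma>(g,h) / \<sigma>(h,g)\<close> is exactly what the factor \<open>\<delta>\<close> in the new commutation factor \<open>\<epsilon>\<delta>\<close> supplies
  (\<open>multiplier_exchange\<close>, \<open>multiplier_cyclic\<close>). That \<open>\<epsilon>\<delta>\<close> is again a skew-symmetric bicharacter
  follows from three instances of the multiplier identity (\<open>multiplier_associated_add_right\<close>).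

  The remaining conditions concern arbitrary elements. An even linear map commutes with taking
  homogeneous components, so if it is multiplicative for \<open>m\<close> then it is multiplicative for
  \<open>m\<^sup>\<sigma>\<close> (\<open>twist_hom\<close>); this one fact applies to \<open>\<alpha>\<close>, to \<open>\<beta>\<close> and to every endomorphism.
\<close>

section \<open>Multipliers and their associated bicharacters\<close>

lemma multiplier_nonzero: "multiplier \<sigma> \<Longrightarrow> \<sigma> g h \<noteq> 0"
  by (simp add: multiplier_def)

lemma multiplier_cocycle:
  "multiplier \<sigma> \<Longrightarrow> \<sigma> g (h + k) * \<sigma> h k = \<sigma> g h * \<sigma> (g + h) k"
  by (simp add: multiplier_def)

lemma associated_bicharacter_swap:
  assumes "multiplier \<sigma>"
  shows "associated_bicharacter \<sigma> g h * \<sigma> h g = \<sigma> g h"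
  using multiplier_nonzero[OF assms] by (simp add: associated_bicharacter_def)

lemma associated_bicharacter_skew:
  assumes "multiplier \<sigma>"
  shows "associated_bicharacter \<sigma> g h * associated_bicharacter \<sigma> h g = 1"
  using multiplier_nonzero[OF assms] by (simp add: associated_bicharacter_def field_simps)

text \<open>Compares the products \<open>x(yz)\<close> and \<open>y(xz)\<close>: both are related by the multiplier identity to
  products \<open>(xy)z\<close> and \<open>(yx)z\<close>, whose weights differ only by \<open>\<sigma>(g,h) / \<sigma>(h,g)\<close>, as \<open>g + h = h + g\<close>.\<close>

lemma multiplier_exchange:
  assumes "multiplier \<sigma>"
  shows "associated_bicharacter \<sigma> g h * (\<sigma> g k * \<sigma> h (g + k)) = \<sigma> h k * \<sigma> g (h + k)"
proof -
  have "associated_bicharacter \<sigma> g h * (\<sigma> g k * \<sigma> h (g + k))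
      = associated_bicharacter \<sigma> g h * (\<sigma> h g * \<sigma> (g + h) k)"
    using multiplier_cocycle[OF assms, of h g k] by (simp add: ac_simps)
  also have "\<dots> = \<sigma> g h * \<sigma> (g + h) k"
    using associated_bicharacter_swap[OF assms, of g h] by (simp add: mult.assoc[symmetric])
  also have "\<dots> = \<sigma> h k * \<sigma> g (h + k)"
    using multiplier_cocycle[OF assms, of g h k] by (simp add: ac_simps)
  finally show ?thesis .
qed

text \<open>The weight that the cyclic sum in the Jacobi identity acquires is the same for each of its
  three terms.\<close>

lemma multiplier_cyclic:
  assumes "multiplier \<sigma>"
  shows "associated_bicharacter \<sigma> k g * (\<sigma> h k * \<sigma> g (h + k))
       = associated_bicharacter \<sigma> g h * (\<sigma> k g * \<sigma> h (k + g))"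
proof -
  have "associated_bicharacter \<sigma> k g * (\<sigma> h k * \<sigma> g (h + k))
      = associated_bicharacter \<sigma> g h * ((associated_bicharacter \<sigma> k g * \<sigma> g k) * \<sigma> h (g + k))"
    by (simp add: multiplier_exchange[OF assms, of g h k, symmetric] ac_simps)
  also have "\<dots> = associated_bicharacter \<sigma> g h * (\<sigma> k g * \<sigma> h (k + g))"
    by (simp add: associated_bicharacter_swap[OF assms] add.commute)
  finally show ?thesis .
qed

text \<open>Moving \<open>g\<close> past \<open>h\<close> and then past \<open>k\<close> costs \<open>\<delta>(g,h)\<close> and \<open>\<delta>(g,k)\<close>; moving it past
  \<open>h + k\<close> in one step must cost the same.\<close>

lemma multiplier_associated_add_right:
  assumes "multiplier \<sigma>"
  shows "associated_bicharacter \<sigma> g (h + k)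
       = associated_bicharacter \<sigma> g h * associated_bicharacter \<sigma> g k"
proof -
  let ?d = "associated_bicharacter \<sigma>"
  have "?d g h * ?d g k * (\<sigma> h k * \<sigma> (h + k) g) = ?d g h * ?d g k * (\<sigma> k g * \<sigma> h (k + g))"
    using multiplier_cocycle[OF assms, of h k g] by (simp add: ac_simps)
  also have "\<dots> = ?d g h * ((?d g k * \<sigma> k g) * \<sigma> h (g + k))"
    by (simp add: ac_simps)
  also have "\<dots> = \<sigma> h k * \<sigma> g (h + k)"
    by (simp add: associated_bicharacter_swap[OF assms] multiplier_exchange[OF assms])
  also have "\<dots> = ?d g (h + k) * (\<sigma> h k * \<sigma> (h + k) g)"
    by (simp add: associated_bicharacter_swap[OF assms, of g "h + k", symmetric] ac_simps)
  finally show ?thesis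
    using multiplier_nonzero[OF assms] by simp
qed

lemma skew_symmetric_bicharacter_associated:
  assumes "multiplier \<sigma>"
  shows "skew_symmetric_bicharacter (associated_bicharacter \<sigma>)"
proof -
  let ?d = "associated_bicharacter \<sigma>"
  have nz: "?d g h \<noteq> 0" for g h
    using multiplier_nonzero[OF assms] by (simp add: associated_bicharacter_def)
  have flip: "?d g h = inverse (?d h g)" for g h
    by (simp add: associated_bicharacter_def)
  have "?d (g + h) k = ?d g k * ?d h k" for g h k
    by (subst (1 2 3) flip) (simp add: multiplier_associated_add_right[OF assms])
  then show ?thesis
    unfolding skew_symmetric_bicharacter_def
    using nz multiplier_associated_add_right[OF assms] associated_bicharacter_skew[OF assms]
    by blast
qed

lemma skew_symmetric_bicharacter_mult:
  assumes "skew_symmetric_bicharacter \<epsilon>" "skew_symmetric_bicharacter \<delta>"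
  shows "skew_symmetric_bicharacter (\<lambda>g h. \<epsilon> g h * \<delta> g h)"
proof -
  have "\<epsilon> g h * \<delta> g h * (\<epsilon> h g * \<delta> h g) = 1" for g h
  proof -
    have "\<epsilon> g h * \<delta> g h * (\<epsilon> h g * \<delta> h g) = (\<epsilon> g h * \<epsilon> h g) * (\<delta> g h * \<delta> h g)"
      by (simp add: ac_simps)
    also have "\<dots> = 1"
      using assms by (simp add: skew_symmetric_bicharacter_def)
    finally show ?thesis .
  qed
  then show ?thesis
    using assms by (auto simp: skew_symmetric_bicharacter_def ac_simps)
qed

section \<open>Homogeneous components\<close>

context graded_vector_space
begin

lemma homogeneous_decomposition_component:
  "homogeneous_decomposition V x (homogeneous_component V x)"
  unfolding homogeneous_component_def by (rule theI'[OF unique_decomposition])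

lemma component_mem: "homogeneous_component V x g \<in> V g"
  using homogeneous_decomposition_component by (simp add: homogeneous_decomposition_def)

lemma finite_component_support: "finite {g. homogeneous_component V x g \<noteq> 0}"
  using homogeneous_decomposition_component by (simp add: homogeneous_decomposition_def)

lemma sum_component:
  assumes "finite S" "{g. homogeneous_component V x g \<noteq> 0} \<subseteq> S"
  shows "(\<Sum>g\<in>S. homogeneous_component V x g) = x"
proof -
  have "x = (\<Sum>g\<in>{g. homogeneous_component V x g \<noteq> 0}. homogeneous_component V x g)"
    using homogeneous_decomposition_component by (simp add: homogeneous_decomposition_def)
  also have "\<dots> = (\<Sum>g\<in>S. homogeneous_component V x g)"
    using assms by (intro sum.mono_neutral_left) auto
  finally show ?thesis by simp
qed

text \<open>Uniqueness of the decomposition, in a form where the finite index set need not be the exact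
  support.\<close>

lemma component_eqI:
  assumes "\<And>g. c g \<in> V g" "finite S" "\<And>g. g \<notin> S \<Longrightarrow> c g = 0" "(\<Sum>g\<in>S. c g) = x"
  shows "homogeneous_component V x = c"
proof -
  have sub: "{g. c g \<noteq> 0} \<subseteq> S" using assms(3) by auto
  have "(\<Sum>g\<in>{g. c g \<noteq> 0}. c g) = (\<Sum>g\<in>S. c g)"
    using sub assms(2) by (intro sum.mono_neutral_left) auto
  then have "homogeneous_decomposition V x c"
    using assms sub finite_subset unfolding homogeneous_decomposition_def by auto
  then show ?thesis
    using unique_decomposition homogeneous_decomposition_component by blast
qed

lemma component_add:
  "homogeneous_component V (x + y)
   = (\<lambda>g. homogeneous_component V x g + homogeneous_component V y g)"
proof (rule component_eqI[where
      S = "{g. homogeneous_component V x g \<noteq> 0} \<union> {g. homogeneous_component V y g \<noteq> 0}"])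
  show "homogeneous_component V x g + homogeneous_component V y g \<in> V g" for g
    using subspace_add[OF subspace_V] component_mem by blast
qed (auto simp: finite_component_support sum.distrib sum_component)

text \<open>The images under \<open>f\<close> of the components of \<open>x\<close> are a homogeneous decomposition of \<open>f x\<close>. Besides the
  structure maps and endomorphisms this covers scalar multiplication, \<open>f = scale a\<close>.\<close>

lemma component_even_linear:
  assumes "Vector_Spaces.linear scale scale f" "even_map V f"
  shows "homogeneous_component V (f x) = (\<lambda>g. f (homogeneous_component V x g))"
proof (rule component_eqI[where S = "{g. homogeneous_component V x g \<noteq> 0}"])
  interpret f: Vector_Spaces.linear scale scale f by (fact assms(1))
  show "f (homogeneous_component V x g) \<in> V g" for g
    using assms(2) component_mem by (simp add: even_map_def)
  show "f (homogeneous_component V x g) = 0" if "g \<notin> {g. homogeneous_component V x g \<noteq> 0}" for g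
    using that f.zero by simp
  show "(\<Sum>g\<in>{g. homogeneous_component V x g \<noteq> 0}. f (homogeneous_component V x g)) = f x"
    by (simp add: f.sum[symmetric] sum_component finite_component_support)
qed (rule finite_component_support)

lemma component_scale:
  "homogeneous_component V (scale a x) = (\<lambda>g. scale a (homogeneous_component V x g))"
  using component_even_linear[OF linear_scale_self, of a x] subspace_scale[OF subspace_V]
  by (simp add: even_map_def)

lemma component_homogeneous:
  assumes "x \<in> V g"
  shows "homogeneous_component V x = (\<lambda>h. if h = g then x else 0)"
  by (rule component_eqI[where S = "{g}"]) (use assms subspace_0[OF subspace_V] in auto)

section \<open>The twist of a bilinear map\<close>

lemma bilinear_map_zero:
  assumes "bilinear_map scale m"
  shows "m x 0 = 0" "m 0 y = 0"
proof -
  interpret l: Vector_Spaces.linear scale scale "m x"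
    using assms by (simp add: bilinear_map_def)
  interpret r: Vector_Spaces.linear scale scale "\<lambda>x. m x y"
    using assms by (simp add: bilinear_map_def)
  show "m x 0 = 0" "m 0 y = 0" by (rule l.zero r.zero)+
qed

lemma bilinear_map_scale:
  assumes "bilinear_map scale m"
  shows "m x (scale a y) = scale a (m x y)" "m (scale a x) y = scale a (m x y)"
proof -
  interpret l: Vector_Spaces.linear scale scale "m x"
    using assms by (simp add: bilinear_map_def)
  interpret r: Vector_Spaces.linear scale scale "\<lambda>x. m x y"
    using assms by (simp add: bilinear_map_def)
  show "m x (scale a y) = scale a (m x y)" "m (scale a x) y = scale a (m x y)"
    by (rule l.scale r.scale)+
qed

lemma bilinear_map_add_right:
  assumes "bilinear_map scale m"
  shows "m x (y + z) = m x y + m x z"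
proof -
  interpret l: Vector_Spaces.linear scale scale "m x"
    using assms by (simp add: bilinear_map_def)
  show ?thesis by (rule l.add)
qed

text \<open>Index sets larger than the supports allow the twists at different arguments to be
  written as sums over a common set.\<close>

lemma twist_eq_sum:
  assumes m: "bilinear_map scale m"
    and S: "finite S" "{g. homogeneous_component V x g \<noteq> 0} \<subseteq> S"
    and T: "finite T" "{h. homogeneous_component V y h \<noteq> 0} \<subseteq> T"
  shows "twist scale V \<sigma> m x y
    = (\<Sum>g\<in>S. \<Sum>h\<in>T. scale (\<sigma> g h) (m (homogeneous_component V x g) (homogeneous_component V y h)))"
proof -
  note m0 = bilinear_map_zero[OF m]
  have "twist scale V \<sigma> m x y
      = (\<Sum>g\<in>{g. homogeneous_component V x g \<noteq> 0}. \<Sum>h\<in>T.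
          scale (\<sigma> g h) (m (homogeneous_component V x g) (homogeneous_component V y h)))"
    unfolding twist_def
    using T by (intro sum.cong refl sum.mono_neutral_left) (auto simp: m0)
  also have "\<dots> = (\<Sum>g\<in>S. \<Sum>h\<in>T.
          scale (\<sigma> g h) (m (homogeneous_component V x g) (homogeneous_component V y h)))"
    using S by (intro sum.mono_neutral_left) (auto simp: m0)
  finally show ?thesis .
qed

lemma twist_homogeneous:
  assumes "bilinear_map scale m" "x \<in> V g" "y \<in> V h"
  shows "twist scale V \<sigma> m x y = scale (\<sigma> g h) (m x y)"
proof -
  have "twist scale V \<sigma> m x y = (\<Sum>g\<in>{g}. \<Sum>h\<in>{h}.
      scale (\<sigma> g h) (m (homogeneous_component V x g) (homogeneous_component V y h)))"
    using assms
    by (intro twist_eq_sum) (auto simp: component_homogeneous split: if_splits)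
  then show ?thesis
    using assms by (simp add: component_homogeneous)
qed

text \<open>The opposite of a twist is a twist of the opposite product; linearity in one argument thus gives
  linearity in the other.\<close>

lemma twist_flip:
  "twist scale V \<sigma> m x y = twist scale V (\<lambda>g h. \<sigma> h g) (\<lambda>x y. m y x) y x"
  unfolding twist_def by (rule sum.swap)

lemma twist_linear_right:
  assumes m: "bilinear_map scale m"
  shows "Vector_Spaces.linear scale scale (twist scale V \<sigma> m x)"
proof (rule Vector_Spaces.linear_iff[THEN iffD2], intro conjI allI vector_space_axioms)
  let ?c = "homogeneous_component V"
  note add = bilinear_map_add_right[OF m] and scl = bilinear_map_scale[OF m]
  let ?S = "{g. ?c x g \<noteq> 0}"
  fix y z a
  let ?T = "{g. ?c y g \<noteq> 0} \<union> {g. ?c z g \<noteq> 0}"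
  have sums: "twist scale V \<sigma> m x u = (\<Sum>g\<in>?S. \<Sum>h\<in>?T. scale (\<sigma> g h) (m (?c x g) (?c u h)))"
    if "{h. ?c u h \<noteq> 0} \<subseteq> ?T" for u
    using that by (intro twist_eq_sum[OF m]) (auto simp: finite_component_support)
  have "twist scale V \<sigma> m x (y + z)
      = (\<Sum>g\<in>?S. \<Sum>h\<in>?T. scale (\<sigma> g h) (m (?c x g) (?c (y + z) h)))"
    by (rule sums) (auto simp: component_add)
  also have "\<dots> = twist scale V \<sigma> m x y + twist scale V \<sigma> m x z"
    by (simp add: sums component_add add scale_right_distrib sum.distrib)
  finally show "twist scale V \<sigma> m x (y + z) = twist scale V \<sigma> m x y + twist scale V \<sigma> m x z" .
  have "twist scale V \<sigma> m x (scale a y)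
      = (\<Sum>g\<in>?S. \<Sum>h\<in>?T. scale (\<sigma> g h) (m (?c x g) (?c (scale a y) h)))"
    by (rule sums) (auto simp: component_scale)
  also have "\<dots> = scale a (twist scale V \<sigma> m x y)"
    by (simp add: sums component_scale scl scale_sum_right mult.commute)
  finally show "twist scale V \<sigma> m x (scale a y) = scale a (twist scale V \<sigma> m x y)" .
qed

lemma twist_bilinear:
  assumes "bilinear_map scale m"
  shows "bilinear_map scale (twist scale V \<sigma> m)"
proof -
  have "bilinear_map scale (\<lambda>x y. m y x)"
    using assms by (simp add: bilinear_map_def)
  from twist_linear_right[OF this]
  have "Vector_Spaces.linear scale scale (\<lambda>x. twist scale V \<sigma> m x y)" for y
    by (subst twist_flip)
  then show ?thesis
    using twist_linear_right[OF assms] by (simp add: bilinear_map_def)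
qed

lemma twist_even:
  assumes "bilinear_map scale m" "even_bimap V m"
  shows "even_bimap V (twist scale V \<sigma> m)"
  using assms(2) subspace_scale[OF subspace_V]
  by (auto simp: even_bimap_def twist_homogeneous[OF assms(1)])

text \<open>Since \<open>f\<close> preserves degrees, the weight \<open>\<sigma>(g,h)\<close> of a pair of components is also the weight of the
  pair of their images, which are the components of \<open>f x\<close> and \<open>f y\<close>.\<close>

lemma twist_hom:
  assumes m: "bilinear_map scale m"
    and f: "Vector_Spaces.linear scale scale f" "even_map V f"
    and hom: "\<And>x y. f (m x y) = m (f x) (f y)"
  shows "f (twist scale V \<sigma> m x y) = twist scale V \<sigma> m (f x) (f y)"
proof -
  interpret f: Vector_Spaces.linear scale scale f by (fact f(1))
  let ?c = "homogeneous_component V"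
  (* f may kill components, so the supports of f x and f y can be smaller. *)
  have "twist scale V \<sigma> m (f x) (f y)
      = (\<Sum>g\<in>{g. ?c x g \<noteq> 0}. \<Sum>h\<in>{h. ?c y h \<noteq> 0}. scale (\<sigma> g h) (m (?c (f x) g) (?c (f y) h)))"
    by (intro twist_eq_sum[OF m])
      (auto simp: finite_component_support component_even_linear[OF f] f.zero)
  then show ?thesis
    by (simp add: twist_def f.sum f.scale hom component_even_linear[OF f])
qed

end

section \<open>Twisting BiHom-Poisson color algebras\<close>

context bihom_poisson_color_algebra
begin

lemma twisted_algebra:
  assumes \<sigma>: "multiplier \<sigma>"
  defines "\<delta> \<equiv> associated_bicharacter \<sigma>"
  shows "bihom_poisson_color_algebra scale V (twist scale V \<sigma> mult) (twist scale V \<sigma> bracket)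
           (\<lambda>g h. \<epsilon> g h * \<delta> g h) \<alpha> \<beta>"
proof
  interpret \<alpha>: Vector_Spaces.linear scale scale \<alpha> by (fact linear_\<alpha>)
  interpret \<beta>: Vector_Spaces.linear scale scale \<beta> by (fact linear_\<beta>)
  let ?m = "twist scale V \<sigma> mult" and ?b = "twist scale V \<sigma> bracket"
  note hm = twist_homogeneous[OF bilinear_mult]
  note hb = twist_homogeneous[OF bilinear_bracket]
  have \<alpha>V: "\<alpha> x \<in> V g" and \<beta>V: "\<beta> x \<in> V g" if "x \<in> V g" for x g
    using that even_\<alpha> even_\<beta> by (auto simp: even_map_def)
  have mV: "mult x y \<in> V (g + h)" and bV: "bracket x y \<in> V (g + h)"
    if "x \<in> V g" "y \<in> V h" for x y g h
    using that even_mult even_bracket by (auto simp: even_bimap_def)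
  have sV: "scale a x \<in> V g" if "x \<in> V g" for a x g
    using that subspace_scale[OF subspace_V] by blast
  note ms = bilinear_map_scale[OF bilinear_mult] and bs = bilinear_map_scale[OF bilinear_bracket]
  show "\<alpha> (x + y) = \<alpha> x + \<alpha> y" "\<alpha> (scale a x) = scale a (\<alpha> x)"
    "\<beta> (x + y) = \<beta> x + \<beta> y" "\<beta> (scale a x) = scale a (\<beta> x)" for x y a
    by (rule \<alpha>.add \<alpha>.scale \<beta>.add \<beta>.scale)+
  show "skew_symmetric_bicharacter (\<lambda>g h. \<epsilon> g h * \<delta> g h)"
    unfolding \<delta>_def
    by (intro skew_symmetric_bicharacter_mult bicharacter skew_symmetric_bicharacter_associated \<sigma>)
  show "bilinear_map scale ?m" "bilinear_map scale ?b" "even_bimap V ?m" "even_bimap V ?b"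
    by (intro twist_bilinear twist_even bilinear_mult bilinear_bracket even_mult even_bracket)+
  show "\<alpha> (?m x y) = ?m (\<alpha> x) (\<alpha> y)" for x y
    by (rule twist_hom[OF bilinear_mult linear_\<alpha> even_\<alpha>, OF \<alpha>_mult])
  show "\<alpha> (?b x y) = ?b (\<alpha> x) (\<alpha> y)" for x y
    by (rule twist_hom[OF bilinear_bracket linear_\<alpha> even_\<alpha>, OF \<alpha>_bracket])
  show "\<beta> (?m x y) = ?m (\<beta> x) (\<beta> y)" for x y
    by (rule twist_hom[OF bilinear_mult linear_\<beta> even_\<beta>, OF \<beta>_mult])
  show "\<beta> (?b x y) = ?b (\<beta> x) (\<beta> y)" for x y
    by (rule twist_hom[OF bilinear_bracket linear_\<beta> even_\<beta>, OF \<beta>_bracket])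
  fix x y g h assume x: "x \<in> V g" and y: "y \<in> V h"
  have "?b (\<beta> x) (\<alpha> y) = - scale (\<sigma> g h * \<epsilon> g h) (bracket (\<beta> y) (\<alpha> x))"
    using x y by (simp add: hb[OF \<beta>V \<alpha>V] bihom_skew_symmetric[OF x y])
  also have "\<sigma> g h * \<epsilon> g h = \<epsilon> g h * \<delta> g h * \<sigma> h g"
    using associated_bicharacter_swap[OF \<sigma>, of g h] by (simp add: \<delta>_def ac_simps)
  finally show "?b (\<beta> x) (\<alpha> y) = - scale (\<epsilon> g h * \<delta> g h) (?b (\<beta> y) (\<alpha> x))"
    using x y by (simp add: hb[OF \<beta>V \<alpha>V])
  fix z k assume z: "z \<in> V k"
  have left: "?m (\<alpha> x) (?m y z) = scale (\<sigma> h k * \<sigma> g (h + k)) (mult (\<alpha> x) (mult y z))"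
    by (simp add: hm[OF y z] hm[OF \<alpha>V[OF x] sV[OF mV[OF y z]]] ms mult.commute)
  have right: "?m (?m x y) (\<beta> z) = scale (\<sigma> g h * \<sigma> (g + h) k) (mult (mult x y) (\<beta> z))"
    by (simp add: hm[OF x y] hm[OF sV[OF mV[OF x y]] \<beta>V[OF z]] ms mult.commute)
  show "?m (\<alpha> x) (?m y z) = ?m (?m x y) (\<beta> z)"
    using multiplier_cocycle[OF \<sigma>, of g h k]
    by (simp add: left right bihom_associative[OF x y z] mult.commute)
  have br: "?b (\<beta> (\<beta> u)) (?b (\<beta> v) (\<alpha> w))
      = scale (\<sigma> b c * \<sigma> a (b + c)) (bracket (\<beta> (\<beta> u)) (bracket (\<beta> v) (\<alpha> w)))"
    if "u \<in> V a" "v \<in> V b" "w \<in> V c" for u v w a b c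
    by (simp add: hb[OF \<beta>V[OF that(2)] \<alpha>V[OF that(3)]] bs mult.commute
        hb[OF \<beta>V[OF \<beta>V[OF that(1)]] sV[OF bV[OF \<beta>V[OF that(2)] \<alpha>V[OF that(3)]]]])
  (* c is the weight shared by the three terms of the Jacobi identity. *)
  define c where "c = \<delta> k g * (\<sigma> h k * \<sigma> g (h + k))"
  have c: "\<delta> k g * (\<sigma> h k * \<sigma> g (h + k)) = c" "\<delta> g h * (\<sigma> k g * \<sigma> h (k + g)) = c"
    "\<delta> h k * (\<sigma> g h * \<sigma> k (g + h)) = c"
    using multiplier_cyclic[OF \<sigma>, of k g h] multiplier_cyclic[OF \<sigma>, of g h k]
    by (simp_all add: c_def \<delta>_def)
  let ?J = "\<lambda>u v w. bracket (\<beta> (\<beta> u)) (bracket (\<beta> v) (\<alpha> w))"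
  have "scale (\<epsilon> k g * \<delta> k g) (?b (\<beta> (\<beta> x)) (?b (\<beta> y) (\<alpha> z))) +
      scale (\<epsilon> g h * \<delta> g h) (?b (\<beta> (\<beta> y)) (?b (\<beta> z) (\<alpha> x))) +
      scale (\<epsilon> h k * \<delta> h k) (?b (\<beta> (\<beta> z)) (?b (\<beta> x) (\<alpha> y)))
      = scale (\<epsilon> k g * c) (?J x y z) + scale (\<epsilon> g h * c) (?J y z x) + scale (\<epsilon> h k * c) (?J z x y)"
    by (simp only: br[OF x y z] br[OF y z x] br[OF z x y] scale_scale mult.assoc c)
  also have "\<dots> = scale c (scale (\<epsilon> k g) (?J x y z) + scale (\<epsilon> g h) (?J y z x)
      + scale (\<epsilon> h k) (?J z x y))"
    by (simp add: scale_right_distrib mult.commute)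
  also have "\<dots> = 0"
    by (simp add: bihom_jacobi[OF x y z])
  finally show "scale (\<epsilon> k g * \<delta> k g) (?b (\<beta> (\<beta> x)) (?b (\<beta> y) (\<alpha> z))) +
      scale (\<epsilon> g h * \<delta> g h) (?b (\<beta> (\<beta> y)) (?b (\<beta> z) (\<alpha> x))) +
      scale (\<epsilon> h k * \<delta> h k) (?b (\<beta> (\<beta> z)) (?b (\<beta> x) (\<alpha> y))) = 0" .
  (* d is the weight shared by the three terms of the Leibniz rule. *)
  define d where "d = \<sigma> h k * \<sigma> g (h + k)"
  have d: "\<sigma> (g + h) k * \<sigma> g h = d" "\<delta> g h * (\<sigma> h (g + k) * \<sigma> g k) = d"
    using multiplier_cocycle[OF \<sigma>, of g h k] multiplier_exchange[OF \<sigma>, of g h k]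
    by (simp_all add: d_def \<delta>_def mult.commute)
  have 1: "?b (\<alpha> (\<beta> x)) (?m y z) = scale d (bracket (\<alpha> (\<beta> x)) (mult y z))"
    by (simp add: d_def hm[OF y z] hb[OF \<alpha>V[OF \<beta>V[OF x]] sV[OF mV[OF y z]]] bs mult.commute)
  have 2: "?m (?b (\<beta> x) y) (\<beta> z) = scale d (mult (bracket (\<beta> x) y) (\<beta> z))"
    by (simp add: d hb[OF \<beta>V[OF x] y] hm[OF sV[OF bV[OF \<beta>V[OF x] y]] \<beta>V[OF z]] ms)
  have 3: "scale (\<epsilon> g h * \<delta> g h) (?m (\<beta> y) (?b (\<alpha> x) z))
      = scale (d * \<epsilon> g h) (mult (\<beta> y) (bracket (\<alpha> x) z))"
    by (simp add: d mult.assoc mult.commute[of d]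
        hb[OF \<alpha>V[OF x] z] hm[OF \<beta>V[OF y] sV[OF bV[OF \<alpha>V[OF x] z]]] ms)
  show "?b (\<alpha> (\<beta> x)) (?m y z) =
      ?m (?b (\<beta> x) y) (\<beta> z) + scale (\<epsilon> g h * \<delta> g h) (?m (\<beta> y) (?b (\<alpha> x) z))"
    by (simp add: 1 2 3 bihom_leibniz[OF x y z] scale_right_distrib)
qed (rule even_\<alpha> even_\<beta> commute)+

lemma twisted_endomorphism:
  assumes "bihom_poisson_endomorphism scale V mult bracket \<alpha> \<beta> f"
  shows "bihom_poisson_endomorphism scale V
           (twist scale V \<sigma> mult) (twist scale V \<sigma> bracket) \<alpha> \<beta> f"
  using assms twist_hom[OF bilinear_mult, of f] twist_hom[OF bilinear_bracket, of f]
  by (simp add: bihom_poisson_endomorphism_def)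

end

theorem theorem3p24:
  fixes scale :: "'k::field \<Rightarrow> 'v::ab_group_add \<Rightarrow> 'v"
    and V :: "'g::ab_group_add \<Rightarrow> 'v set"
    and mult bracket :: "'v \<Rightarrow> 'v \<Rightarrow> 'v"
    and \<epsilon> \<sigma> \<delta> :: "'g \<Rightarrow> 'g \<Rightarrow> 'k"
    and \<alpha> \<beta> :: "'v \<Rightarrow> 'v"
  assumes "CHAR('k) \<noteq> 2"
    and "bihom_poisson_color_algebra scale V mult bracket \<epsilon> \<alpha> \<beta>"
    and "multiplier \<sigma>"
    and "\<delta> = associated_bicharacter \<sigma>"
  shows "(\<forall>g h. \<forall>x\<in>V g. \<forall>y\<in>V h.
             twist scale V \<sigma> mult x y = scale (\<sigma> g h) (mult x y) \<and>
             twist scale V \<sigma> bracket x y = scale (\<sigma> g h) (bracket x y)) \<and>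
         bihom_poisson_color_algebra scale V (twist scale V \<sigma> mult) (twist scale V \<sigma> bracket)
           (\<lambda>g h. \<epsilon> g h * \<delta> g h) \<alpha> \<beta> \<and>
         (\<forall>f. bihom_poisson_endomorphism scale V mult bracket \<alpha> \<beta> f \<longrightarrow>
              bihom_poisson_endomorphism scale V
                (twist scale V \<sigma> mult) (twist scale V \<sigma> bracket) \<alpha> \<beta> f)"
proof -
  interpret bihom_poisson_color_algebra scale V mult bracket \<epsilon> \<alpha> \<beta>
    by (fact assms(2))
  show ?thesis
    using twist_homogeneous[OF bilinear_mult] twist_homogeneous[OF bilinear_bracket]
      twisted_algebra[OF assms(3)] twisted_endomorphism
    unfolding assms(4) by blast
qed

end
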